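(* Let $X\sim\mathrm{Unif}[0,1]$, let $\beta_1^\star\neq\beta_2^\star$ be vectors in $\mathbb{R}^J$, let $\alpha^\star:[0,1]\to[0,1]$ be nondecreasing, and let $w^\star(x)=\alpha^\star(x)\beta_1^\star+(1-\alpha^\star(x))\beta_2^\star$. Let $$\mathcal{W}^{\mathrm{pool}}=\{w:[0,1]\to\mathbb{R}^J : w(x)\equiv\beta\text{ for some }\beta\in\mathbb{R}^J\}$$ and $\Delta\beta^\star:=\beta_1^\star-\beta_2^\star$. Then $$\inf_{w\in\mathcal{W}^{\mathrm{pool}}}\mathbb{E}\left[\|w^\star(X)-w(X)\|_2^2\right]=\|\Delta\beta^\star\|_2^2\,\mathrm{Var}(\alpha^\star(X)).$$ *)

theory Defs
  imports "HOL-Probability.Probability"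
begin

(* Functions on [0,1] are total functions on the reals of which only the values on [0,1] matter. *)
definition W_pool :: "(real \<Rightarrow> real ^ 'J) set" where
  "W_pool = {w. \<exists>\<beta>. \<forall>x\<in>{0..1}. w x = \<beta>}"

definition mixture_weight :: "(real \<Rightarrow> real) \<Rightarrow> real ^ 'J \<Rightarrow> real ^ 'J \<Rightarrow> real \<Rightarrow> real ^ 'J" where
  "mixture_weight \<alpha> \<beta>\<^sub>1 \<beta>\<^sub>2 x = \<alpha> x *\<^sub>R \<beta>\<^sub>1 + (1 - \<alpha> x) *\<^sub>R \<beta>\<^sub>2"

end

(* With \<mu> the mean of \<alpha>(X) and m = \<mu> \<beta>1 + (1 - \<mu>) \<beta>2, the error of the constant \<beta> is
   (\<alpha>(X) - \<mu>)(\<beta>1 - \<beta>2) + (m - \<beta>). The cross term has mean zero, so the risk is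
   |\<beta>1 - \<beta>2|^2 Var(\<alpha>(X)) + |m - \<beta>|^2, which is minimal at \<beta> = m. *)

theory Submission
  imports Defs
begin

text \<open>Pointwise the squared norm is a quadratic polynomial in the centered variable. Its
  linear term integrates to zero, so only the variance term and the constant survive. Only scalar
  functions are integrated.\<close>

lemma (in prob_space) expectation_norm_centered_shift:
  fixes A :: "'a \<Rightarrow> real" and u v :: "'b :: real_inner"
  assumes A: "integrable M A" and A2: "integrable M (\<lambda>\<omega>. (A \<omega>)\<^sup>2)"
  shows "expectation (\<lambda>\<omega>. (norm ((A \<omega> - expectation A) *\<^sub>R v + u))\<^sup>2) =
    (norm v)\<^sup>2 * variance A + (norm u)\<^sup>2"
proof -
  define \<mu> where "\<mu> = expectation A"
  have dev: "integrable M (\<lambda>\<omega>. A \<omega> - \<mu>)"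
    using A by simp
  have dev2: "integrable M (\<lambda>\<omega>. (A \<omega> - \<mu>)\<^sup>2)"
    using A A2 by (simp add: power2_diff)
  have centered: "expectation (\<lambda>\<omega>. A \<omega> - \<mu>) = 0"
    using A by (simp add: \<mu>_def prob_space)
  \<comment> \<open>Stated for a fixed real \<open>t\<close>, so that the vectors enter the integral
    only as constant coefficients of 1, \<open>t\<close> and the square of \<open>t\<close>.\<close>
  have "(norm (t *\<^sub>R v + u))\<^sup>2 = (norm v)\<^sup>2 * t\<^sup>2 + 2 * (v \<bullet> u) * t + (norm u)\<^sup>2" for t
    unfolding power2_norm_eq_inner
    by (simp add: inner_add inner_commute[of u v] power2_eq_square algebra_simps)
  then have "expectation (\<lambda>\<omega>. (norm ((A \<omega> - \<mu>) *\<^sub>R v + u))\<^sup>2) =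
      expectation (\<lambda>\<omega>. (norm v)\<^sup>2 * (A \<omega> - \<mu>)\<^sup>2 + 2 * (v \<bullet> u) * (A \<omega> - \<mu>) + (norm u)\<^sup>2)"
    by simp
  also have "\<dots> = (norm v)\<^sup>2 * expectation (\<lambda>\<omega>. (A \<omega> - \<mu>)\<^sup>2) +
      2 * (v \<bullet> u) * expectation (\<lambda>\<omega>. A \<omega> - \<mu>) + (norm u)\<^sup>2"
    using dev dev2
    by (subst Bochner_Integration.integral_add;
        simp add: prob_space del: Bochner_Integration.integral_diff)+
  finally show ?thesis
    using centered by (simp add: \<mu>_def)
qed

text \<open>Monotonicity on \<open>S\<close> says nothing about \<open>f\<close> elsewhere, so
  \<open>f\<close> is measurable only on the restricted space. Since \<open>X\<close> stays in
  \<open>S\<close>, it can be taken as a map into that space. This supplies the measurability of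
  \<alpha>(X).\<close>

lemma measurable_mono_on_comp:
  fixes f X :: "_ \<Rightarrow> real"
  assumes X: "X \<in> borel_measurable M" "X \<in> space M \<rightarrow> S" and f: "mono_on S f"
  shows "(\<lambda>\<omega>. f (X \<omega>)) \<in> borel_measurable M"
proof -
  have "X \<in> measurable M (restrict_space borel S)"
    using X by (simp add: measurable_restrict_space2_iff)
  then show ?thesis
    using borel_measurable_mono_on_fnc[OF f] by (rule measurable_compose)
qed

theorem proposition3:
  fixes M :: "'a measure" and X :: "'a \<Rightarrow> real"
    and \<alpha> :: "real \<Rightarrow> real" and \<beta>\<^sub>1 \<beta>\<^sub>2 :: "real ^ 'J"
  assumes "prob_space M"
    and "distributed M lborel X (\<lambda>x. ennreal (indicator {0..1} x / measure lborel {0..1}))"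
    and "X \<in> space M \<rightarrow> {0..1}"
    and "\<beta>\<^sub>1 \<noteq> \<beta>\<^sub>2"
    and "\<alpha> \<in> {0..1} \<rightarrow> {0..1}"
    and "mono_on {0..1} \<alpha>"
  shows "(INF w\<in>W_pool. prob_space.expectation M
            (\<lambda>\<omega>. (norm (mixture_weight \<alpha> \<beta>\<^sub>1 \<beta>\<^sub>2 (X \<omega>) - w (X \<omega>)))\<^sup>2))
         = (norm (\<beta>\<^sub>1 - \<beta>\<^sub>2))\<^sup>2 * prob_space.variance M (\<lambda>\<omega>. \<alpha> (X \<omega>))"
proof -
  interpret prob_space M by fact
  define A where "A = (\<lambda>\<omega>. \<alpha> (X \<omega>))"
  define m where "m = expectation A *\<^sub>R \<beta>\<^sub>1 + (1 - expectation A) *\<^sub>R \<beta>\<^sub>2"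
  let ?risk = "\<lambda>w. expectation (\<lambda>\<omega>. (norm (mixture_weight \<alpha> \<beta>\<^sub>1 \<beta>\<^sub>2 (X \<omega>) - w (X \<omega>)))\<^sup>2)"
  have "X \<in> borel_measurable M"
    using distributed_measurable[OF assms(2)] by simp
  then have meas: "A \<in> borel_measurable M"
    unfolding A_def using assms(3,6) by (rule measurable_mono_on_comp)
  have bound: "0 \<le> A \<omega> \<and> A \<omega> \<le> 1" if "\<omega> \<in> space M" for \<omega>
    proof -
    have "X \<omega> \<in> {0..1}"
      using assms(3) that by (rule funcset_mem)
    then have "\<alpha> (X \<omega>) \<in> {0..1}"
      by (rule funcset_mem[OF assms(5)])
    then show ?thesis
      by (simp add: A_def)
  qed
  \<comment> \<open>On a probability space, values in [0,1] make both the first and the second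
    moment finite.\<close>
  have A: "integrable M A"
    by (rule integrable_const_bound[where B = 1]) (use meas bound in auto)
  have A2: "integrable M (\<lambda>\<omega>. (A \<omega>)\<^sup>2)"
    by (rule integrable_const_bound[where B = 1]) (use meas bound in \<open>auto intro: power_le_one\<close>)
  \<comment> \<open>Any \<open>w\<close> in the pooled class may be arbitrary outside [0,1]. As
    \<open>X\<close> never leaves that interval, the risk sees only the constant value
    \<beta>.\<close>
  have risk: "?risk w = (norm (\<beta>\<^sub>1 - \<beta>\<^sub>2))\<^sup>2 * variance A + (norm (m - \<beta>))\<^sup>2"
    if "\<forall>x\<in>{0..1}. w x = \<beta>" for w \<beta>
  proof -
    \<comment> \<open>The mixture is affine in its weight with slope
      \<open>\<beta>\<^sub>1 - \<beta>\<^sub>2\<close>, and \<open>m\<close> is its value at the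
      mean weight. Adding and subtracting \<open>m\<close> gives the form of the lemma on centered
      shifts.\<close>
    have "mixture_weight \<alpha> \<beta>\<^sub>1 \<beta>\<^sub>2 (X \<omega>) - w (X \<omega>) =
        (A \<omega> - expectation A) *\<^sub>R (\<beta>\<^sub>1 - \<beta>\<^sub>2) + (m - \<beta>)" if "\<omega> \<in> space M" for \<omega>
    proof -
      have "w (X \<omega>) = \<beta>"
        using assms(3) \<open>\<forall>x\<in>{0..1}. w x = \<beta>\<close> that by blast
      then show ?thesis
        by (simp add: mixture_weight_def A_def m_def algebra_simps)
    qed
    then have "?risk w =
        expectation (\<lambda>\<omega>. (norm ((A \<omega> - expectation A) *\<^sub>R (\<beta>\<^sub>1 - \<beta>\<^sub>2) + (m - \<beta>)))\<^sup>2)"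
      by (intro Bochner_Integration.integral_cong) auto
    then show ?thesis
      by (simp only: expectation_norm_centered_shift[OF A A2])
  qed
  have "(INF w\<in>W_pool. ?risk w) = (norm (\<beta>\<^sub>1 - \<beta>\<^sub>2))\<^sup>2 * variance A"
  \<comment> \<open>An infimum of reals is meaningful only for a nonempty set that is bounded below.
    Exhibiting an attained minimum settles both conditions and the value at once.\<close>
  proof (rule cInf_eq_minimum)
    have "(\<lambda>_. m) \<in> W_pool"
      by (auto simp: W_pool_def)
    then have "?risk (\<lambda>_. m) \<in> ?risk ` W_pool"
      by (rule imageI)
    then show "(norm (\<beta>\<^sub>1 - \<beta>\<^sub>2))\<^sup>2 * variance A \<in> ?risk ` W_pool"
      using risk[of "\<lambda>_. m" m] by simp
  next
    fix r assume "r \<in> ?risk ` W_pool"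
    then obtain w \<beta> where r: "r = ?risk w" and w: "\<forall>x\<in>{0..1}. w x = \<beta>"
      by (auto simp: W_pool_def)
    \<comment> \<open>The excess of the risk \<open>r\<close> over the claimed minimum is the
      squared distance from \<beta> to \<open>m\<close>.\<close>
    then show "(norm (\<beta>\<^sub>1 - \<beta>\<^sub>2))\<^sup>2 * variance A \<le> r"
      unfolding r risk[OF w] by simp
  qed
  then show ?thesis
    by (simp only: A_def)
qed

end
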